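(* There is a partial recursive function $o:\mathbb{R}^3\rightarrow \{0,1\}^{\omega}$ such that for every superperfect set $P\subseteq(\omega)^{\omega}$ we have $o''(P^3)=\{0,1\}^{\omega}$, i.e. for every $\alpha\in\{0,1\}^\omega$ there are $x,y,z\in P$ with $o(x,y,z)$ defined and equal to $\alpha$.
   Context: The set of reals $\mathbb{R}$ is identified with $(\omega)^{\omega}$, the set of all infinite strictly increasing sequences of natural numbers; $(\omega)^{<\omega}$ denotes the set of finite strictly increasing sequences of natural numbers, a tree under inclusion. For a subtree $T$ of $(\omega)^{<\omega}$, a node $s\in T$ is $\omega$-splitting if $\{k: s^\frown k\in T\}$ is infinite; $T$ is superperfect if above every node of $T$ there is an $\omega$-splitting node of $T$. A set $P\subseteq(\omega)^\omega$ is superperfect if the set of all finite initial segments of members of $P$ forms a superperfect tree.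
   Formalization: Superperfect sets are here also required to be closed in (ω)^ω and nonempty; with only the condition on initial segments the claim fails for a countable dense set and for the empty set. *)

theory Defs
  imports "HOL-Analysis.Function_Topology" "HOL-Library.Sublist"
begin

text \<open>\<open>incr_seqs\<close> is the set of reals, identified with the infinite strictly increasing
  sequences of natural numbers.\<close>

definition incr_seqs :: "(nat \<Rightarrow> nat) set"
  where "incr_seqs = {x. strict_mono x}"

definition fin_incr_seqs :: "nat list set"
  where "fin_incr_seqs = {s. sorted_wrt (<) s}"

definition binary_seqs :: "(nat \<Rightarrow> nat) set"
  where "binary_seqs = {\<alpha>. \<forall>n. \<alpha> n \<in> {0, 1}}"

definition subtree :: "nat list set \<Rightarrow> bool"
  where "subtree T \<longleftrightarrow> T \<subseteq> fin_incr_seqs \<and> (\<forall>s\<in>T. \<forall>t. prefix t s \<longrightarrow> t \<in> T)"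

definition omega_splitting :: "nat list set \<Rightarrow> nat list \<Rightarrow> bool"
  where "omega_splitting T s \<longleftrightarrow> s \<in> T \<and> infinite {k. s @ [k] \<in> T}"

text \<open>The empty tree is excluded.\<close>

definition superperfect_tree :: "nat list set \<Rightarrow> bool"
  where "superperfect_tree T \<longleftrightarrow>
    subtree T \<and> T \<noteq> {} \<and> (\<forall>s\<in>T. \<exists>t. prefix s t \<and> omega_splitting T t)"

definition initial_segments :: "(nat \<Rightarrow> nat) set \<Rightarrow> nat list set"
  where "initial_segments P = {map x [0..<n] | x n. x \<in> P}"

text \<open>Superperfect sets are required to be closed, that is, to be the set of branches of a
  superperfect tree. The product topology on \<open>nat \<Rightarrow> nat\<close> is that of Baire space, since
  the topology of \<open>nat\<close> is discrete. Without closedness, a countable dense subset of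
  \<open>incr_seqs\<close> would qualify.\<close>

definition superperfect :: "(nat \<Rightarrow> nat) set \<Rightarrow> bool"
  where "superperfect P \<longleftrightarrow>
    closedin (top_of_set incr_seqs) P \<and> superperfect_tree (initial_segments P)"

text \<open>Partial recursive functionals in the sense of Kleene: programs are built from the
  initial functions and the oracles by composition, primitive recursion and minimisation.
  Programs carry no arity; a program determines a partial function on argument lists of
  each length, undefined where the arguments do not fit.\<close>

datatype prog =
    Zero
  | Succ
  | Proj nat
  | Oracle nat
  | Comp prog "prog list"
  | PrimRec prog prog
  | Mu prog

text \<open>\<open>computes X p ns r\<close>: with oracles \<open>X\<close>, program \<open>p\<close> halts on arguments \<open>ns\<close> with value
  \<open>r\<close>. The recursion and minimisation variable is the first argument.\<close>

inductive computes :: "(nat \<Rightarrow> nat) list \<Rightarrow> prog \<Rightarrow> nat list \<Rightarrow> nat \<Rightarrow> bool"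
  for X where
  Zero: "computes X Zero ns 0"
| Succ: "computes X Succ [n] (Suc n)"
| Proj: "i < length ns \<Longrightarrow> computes X (Proj i) ns (ns ! i)"
| Oracle: "i < length X \<Longrightarrow> computes X (Oracle i) [n] ((X ! i) n)"
| Comp: "list_all2 (\<lambda>q m. computes X q ns m) qs ms \<Longrightarrow> computes X p ms r
    \<Longrightarrow> computes X (Comp p qs) ns r"
| PrimRec_0: "computes X p ns r \<Longrightarrow> computes X (PrimRec p q) (0 # ns) r"
| PrimRec_Suc: "computes X (PrimRec p q) (n # ns) m \<Longrightarrow> computes X q (n # m # ns) r
    \<Longrightarrow> computes X (PrimRec p q) (Suc n # ns) r"
| Mu: "computes X p (n # ns) 0 \<Longrightarrow> (\<forall>m<n. \<exists>k. computes X p (m # ns) (Suc k))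
    \<Longrightarrow> computes X (Mu p) ns n"

lemma computes_deterministic:
  "computes X p ns r \<Longrightarrow> computes X p ns r' \<Longrightarrow> r = r'"
proof (induction arbitrary: r' rule: computes.induct)
  case (Comp ns qs ms p r)
  from Comp.prems obtain ms' where ms': "list_all2 (\<lambda>q m. computes X q ns m) qs ms'"
    and r': "computes X p ms' r'"
    by (auto elim: computes.cases)
  have "ms = ms'"
    using Comp.IH(1) ms' by (auto simp: list_all2_conv_all_nth intro!: nth_equalityI)
  then show ?case using Comp.IH(2) r' by simp
next
  case (PrimRec_0 p ns r q)
  from PrimRec_0.prems show ?case by cases (auto intro: PrimRec_0.IH)
next
  case (PrimRec_Suc p q n ns m r)
  from PrimRec_Suc.prems show ?case by cases (auto dest: PrimRec_Suc.IH)
next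
  case (Mu p n ns)
  from Mu.prems obtain zero: "computes X p (r' # ns) 0"
    and pos: "\<forall>m<r'. \<exists>k. computes X p (m # ns) (Suc k)"
    by (auto elim: computes.cases)
  have "\<not> n < r'" using pos Mu.IH(1) by fastforce
  moreover have "\<not> r' < n" using Mu.IH(2) zero by fastforce
  ultimately show ?case by simp
qed (auto elim: computes.cases)

text \<open>A partial function from triples of reals to binary sequences is partial recursive if
  one program, given the triple as oracles, computes the value sequence digit by digit; the
  value is defined exactly when the program halts with a binary digit on every input.\<close>

definition partial_recursive ::
    "((nat \<Rightarrow> nat) \<times> (nat \<Rightarrow> nat) \<times> (nat \<Rightarrow> nat) \<rightharpoonup> (nat \<Rightarrow> nat)) \<Rightarrow> bool"
  where "partial_recursive f \<longleftrightarrow>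
    dom f \<subseteq> incr_seqs \<times> incr_seqs \<times> incr_seqs \<and>
    (\<exists>p. \<forall>x\<in>incr_seqs. \<forall>y\<in>incr_seqs. \<forall>z\<in>incr_seqs. \<forall>\<alpha>.
      f (x, y, z) = Some \<alpha> \<longleftrightarrow>
        \<alpha> \<in> binary_seqs \<and> (\<forall>n. computes [x, y, z] p [n] (\<alpha> n)))"

end

theory Submission
  imports Defs
begin

text \<open>Let \<open>s\<close> be an \<open>\<omega>\<close>-splitting node of the tree of \<open>P\<close>. Three branches \<open>x\<close>, \<open>y\<close>, \<open>z\<close> through
  \<open>s\<close> are extended in turn from splitting node to splitting node, each time starting with a number
  larger than everything chosen so far. The entries added in one step form a block of uncontrolled
  length, but the order of the blocks is free: in round \<open>n\<close> a block of \<open>x\<close> comes first, followed by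
  blocks of \<open>y\<close> and \<open>z\<close> in this order if \<open>\<alpha> n = 0\<close>, and in the opposite order if \<open>\<alpha> n = 1\<close>.

  If \<open>a\<close> is the first number of the block of \<open>x\<close> in round \<open>n\<close>, then the block of \<open>y\<close> starts with the
  least \<open>b > a\<close> in \<open>y\<close>, the block of \<open>z\<close> with the least \<open>c > a\<close> in \<open>z\<close>, and the next block of \<open>x\<close>
  with the least \<open>a' > b\<close> in \<open>x\<close>, so the digit is decoded by comparing \<open>b\<close> and \<open>c\<close>. As the
  branches share the stem \<open>s\<close>, round \<open>0\<close> starts at the least \<open>i\<close> with \<open>x i < y i\<close>.\<close>

section \<open>The decoding program\<close>

lemma computes_Comp1:
  "computes X q ns m \<Longrightarrow> computes X p [m] r \<Longrightarrow> computes X (Comp p [q]) ns r"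
  by (rule computes.Comp[where ms = "[m]"]) auto

lemma computes_Comp2:
  "computes X q ns m \<Longrightarrow> computes X q' ns m' \<Longrightarrow> computes X p [m, m'] r
    \<Longrightarrow> computes X (Comp p [q, q']) ns r"
  by (rule computes.Comp[where ms = "[m, m']"]) auto

lemma computes_Proj0: "computes X (Proj 0) (n # ns) n"
  using computes.Proj[of 0 "n # ns" X] by simp

lemma computes_Proj1: "computes X (Proj (Suc 0)) (m # n # ns) n"
  using computes.Proj[of "Suc 0" "m # n # ns" X] by simp

definition pred_prog :: prog
  where "pred_prog = PrimRec Zero (Proj 0)"

lemma computes_pred: "computes X pred_prog [n] (n - 1)"
  unfolding pred_prog_def
proof (induction n)
  case 0
  show ?case by (auto intro: computes.intros)
next
  case (Suc n)
  show ?case using computes.PrimRec_Suc[OF Suc computes_Proj0] by simp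
qed

text \<open>The subtrahend comes first because primitive recursion runs on the first
  argument.\<close>

definition rsub_prog :: prog
  where "rsub_prog = PrimRec (Proj 0) (Comp pred_prog [Proj (Suc 0)])"

lemma computes_rsub: "computes X rsub_prog [n, m] (m - n)"
  unfolding rsub_prog_def
proof (induction n)
  case 0
  show ?case using computes.PrimRec_0[OF computes_Proj0] by simp
next
  case (Suc n)
  show ?case
    using computes.PrimRec_Suc[OF Suc computes_Comp1[OF computes_Proj1 computes_pred]] by simp
qed

text \<open>The value \<open>0\<close> stands for truth, as required by minimisation.\<close>

definition less_prog :: "prog \<Rightarrow> prog \<Rightarrow> prog"
  where "less_prog p q = Comp rsub_prog [q, Comp Succ [p]]"

lemma computes_less:
  "computes X p ns m \<Longrightarrow> computes X q ns n \<Longrightarrow> computes X (less_prog p q) ns (Suc m - n)"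
  unfolding less_prog_def by (meson computes.Succ computes_Comp1 computes_Comp2 computes_rsub)

lemma computes_Mu_less:
  assumes "\<And>i. computes X p (i # ns) (u i)" and "\<And>i. computes X q (i # ns) (v i)"
    and "u n < v n" and "\<And>i. i < n \<Longrightarrow> v i \<le> u i"
  shows "computes X (Mu (less_prog p q)) ns n"
proof (rule computes.Mu)
  show "computes X (less_prog p q) (n # ns) 0"
    using computes_less[OF assms(1,2), of n] assms(3) by simp
  show "\<forall>m<n. \<exists>k. computes X (less_prog p q) (m # ns) (Suc k)"
  proof (intro allI impI)
    fix m
    assume "m < n"
    then have "Suc (u m) - v m = Suc (u m - v m)"
      using assms(4) by (simp add: Suc_diff_le)
    then show "\<exists>k. computes X (less_prog p q) (m # ns) (Suc k)"
      using computes_less[OF assms(1,2), of m] by metis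
  qed
qed

text \<open>Inside the search, \<open>Proj 0\<close> is the candidate position and
  \<open>Proj (Suc 0)\<close> the bound to be exceeded.\<close>

definition next_prog :: "nat \<Rightarrow> prog"
  where "next_prog k = Comp (Oracle k) [Mu (less_prog (Proj (Suc 0)) (Comp (Oracle k) [Proj 0]))]"

lemma computes_next:
  assumes "k < length X" and "m < (X ! k) n" and "\<And>i. i < n \<Longrightarrow> (X ! k) i \<le> m"
  shows "computes X (next_prog k) [m] ((X ! k) n)"
  unfolding next_prog_def
proof (rule computes_Comp1)
  show "computes X (Oracle k) [n] ((X ! k) n)"
    using assms(1) by (rule computes.Oracle)
  show "computes X (Mu (less_prog (Proj (Suc 0)) (Comp (Oracle k) [Proj 0]))) [m] n"
    by (rule computes_Mu_less[where u = "\<lambda>_. m" and v = "X ! k"])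
      (use assms in \<open>auto intro: computes_Comp1 computes_Proj0 computes_Proj1 computes.Oracle\<close>)
qed

text \<open>Tracks the first entry of the block of \<open>x\<close> rather than its position; in the
  recursion \<open>Proj (Suc 0)\<close> is that entry for the previous round.\<close>

definition block_prog :: prog
  where "block_prog =
    PrimRec
      (Comp (Oracle 0)
        [Mu (less_prog (Comp (Oracle 0) [Proj 0]) (Comp (Oracle 1) [Proj 0]))])
      (Comp (next_prog 0) [Comp (next_prog 1) [Proj (Suc 0)]])"

text \<open>Subtracting the comparison from 1 turns its truth value 0 into the digit 1 and any
  positive value into 0.\<close>

definition decode_prog :: prog
  where "decode_prog =
    Comp (Comp rsub_prog [less_prog (next_prog 2) (next_prog 1), Comp Succ [Zero]]) [block_prog]"

text \<open>\<open>I n\<close>, \<open>J n\<close>, \<open>K n\<close> are the positions in \<open>x\<close>, \<open>y\<close>, \<open>z\<close> at which the blocks of round \<open>n\<close> begin.\<close>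

lemma computes_decode:
  fixes x y z I J K \<alpha> :: "nat \<Rightarrow> nat"
  assumes start: "I 0 = J 0" "\<And>i. i < I 0 \<Longrightarrow> x i = y i"
    and y: "\<And>n i. i < J n \<Longrightarrow> y i \<le> x (I n)" "\<And>n. x (I n) < y (J n)"
    and z: "\<And>n i. i < K n \<Longrightarrow> z i \<le> x (I n)" "\<And>n. x (I n) < z (K n)"
    and x: "\<And>n i. i < I (Suc n) \<Longrightarrow> x i \<le> y (J n)" "\<And>n. y (J n) < x (I (Suc n))"
    and digit: "\<And>n. z (K n) < y (J n) \<longleftrightarrow> \<alpha> n = 1" and "\<alpha> \<in> binary_seqs"
  shows "computes [x, y, z] decode_prog [n] (\<alpha> n)"
proof -
  have next_x: "computes [x, y, z] (next_prog 0) [y (J n)] (x (I (Suc n)))" for n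
    using computes_next[of 0 "[x, y, z]" "y (J n)" "I (Suc n)"] x by simp
  have next_y: "computes [x, y, z] (next_prog 1) [x (I n)] (y (J n))" for n
    using computes_next[of 1 "[x, y, z]" "x (I n)" "J n"] y by simp
  have next_z: "computes [x, y, z] (next_prog 2) [x (I n)] (z (K n))" for n
    using computes_next[of 2 "[x, y, z]" "x (I n)" "K n"] z by simp
  have oracles: "computes [x, y, z] (Oracle 0) [n] (x n)" "computes [x, y, z] (Oracle 1) [n] (y n)"
    for n
    using computes.Oracle[of 0 "[x, y, z]" n] computes.Oracle[of 1 "[x, y, z]" n] by simp_all
  have block: "computes [x, y, z] block_prog [n] (x (I n))" for n
    unfolding block_prog_def
  proof (induction n)
    case 0
    \<comment> \<open>\<open>x\<close> and \<open>y\<close> agree on the stem, and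
      \<open>x (I 0) < y (J 0) = y (I 0)\<close>, so the search stops at \<open>I 0\<close>.\<close>
    have "computes [x, y, z]
        (Mu (less_prog (Comp (Oracle 0) [Proj 0]) (Comp (Oracle 1) [Proj 0]))) [] (I 0)"
      by (rule computes_Mu_less[where u = x and v = y])
        (use start y(2)[of 0] in \<open>auto simp del: One_nat_def intro: computes_Comp1 computes_Proj0 oracles\<close>)
    then show ?case
      by (intro computes.PrimRec_0 computes_Comp1[OF _ oracles(1)])
  next
    case (Suc n)
    show ?case
      by (rule computes.PrimRec_Suc[OF Suc])
        (rule computes_Comp1[OF computes_Comp1[OF computes_Proj1 next_y] next_x])
  qed
  have one: "computes [x, y, z] (Comp Succ [Zero]) ns 1" for ns
    using computes_Comp1[OF computes.Zero computes.Succ] by simp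
  have "1 - (Suc (z (K n)) - y (J n)) = \<alpha> n"
    using digit[of n] \<open>\<alpha> \<in> binary_seqs\<close> by (auto simp: binary_seqs_def)
  moreover have "computes [x, y, z] decode_prog [n] (1 - (Suc (z (K n)) - y (J n)))"
    unfolding decode_prog_def
    by (intro computes_Comp1[OF block] computes_Comp2[OF _ one computes_rsub] computes_less
        next_y next_z)
  ultimately show ?thesis by simp
qed

section \<open>Branches of superperfect trees\<close>

text \<open>One of the infinitely many successors of \<open>s\<close> exceeds \<open>m\<close>, and
  a splitting node lies above it.\<close>

lemma omega_splitting_extend:
  assumes "superperfect_tree T" and "omega_splitting T s"
  obtains t where "omega_splitting T t" "strict_prefix s t" "m < t ! length s"
proof -
  have "infinite {k. s @ [k] \<in> T}"
    using assms(2) by (simp add: omega_splitting_def)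
  then obtain k where "m < k" "s @ [k] \<in> T"
    by (auto simp: infinite_nat_iff_unbounded)
  then obtain t where t: "prefix (s @ [k]) t" "omega_splitting T t"
    using assms(1) by (auto simp: superperfect_tree_def)
  show thesis
  proof
    show "omega_splitting T t" by fact
    show "strict_prefix s t"
      using t(1) by (auto simp: strict_prefix_def prefix_def)
    show "m < t ! length s"
      using t(1) \<open>m < k\<close> by (auto simp: prefix_def nth_append)
  qed
qed

text \<open>Strict growth gives \<open>\<sigma> (Suc i)\<close> an entry at position
  \<open>i\<close>, and all longer members of the chain keep it.\<close>

lemma chain_limit:
  fixes \<sigma> :: "nat \<Rightarrow> 'a list"
  assumes "\<And>n. strict_prefix (\<sigma> n) (\<sigma> (Suc n))"
  obtains x where "\<And>n. map x [0..<length (\<sigma> n)] = \<sigma> n"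
proof
  define x where "x i = \<sigma> (Suc i) ! i" for i
  have mono: "prefix (\<sigma> m) (\<sigma> n)" if "m \<le> n" for m n
    using that by (rule prefix_order.lift_Suc_mono_le[rotated])
      (use assms in \<open>auto simp: strict_prefix_def\<close>)
  have len: "n \<le> length (\<sigma> n)" for n
  proof (induction n)
    case (Suc n)
    then show ?case using prefix_length_less[OF assms, of n] by simp
  qed simp
  have "x i = \<sigma> n ! i" if "i < length (\<sigma> n)" for i n
  proof -
    have "i < length (\<sigma> (Suc i))" using len[of "Suc i"] by simp
    then show ?thesis
      unfolding x_def using that mono[of "Suc i" n] mono[of n "Suc i"]
      by (cases "Suc i \<le> n") (auto simp: prefix_def nth_append)
  qed
  then show "map x [0..<length (\<sigma> n)] = \<sigma> n" for n
    by (intro nth_equalityI) auto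
qed

text \<open>Closedness enters here: members of \<open>P\<close> that agree with \<open>x\<close> on
  ever longer initial segments converge to \<open>x\<close>.\<close>

lemma superperfect_branch:
  assumes "superperfect P" and "\<And>n. map x [0..<n] \<in> initial_segments P"
  shows "x \<in> P"
proof -
  obtain C where C: "closed C" "P = incr_seqs \<inter> C"
    using assms(1) by (auto simp: superperfect_def closedin_closed)
  have "\<exists>y\<in>P. \<forall>i<n. y i = x i" for n
  proof -
    obtain y m where y: "y \<in> P" "map x [0..<n] = map y [0..<m]"
      using assms(2)[of n] by (auto simp: initial_segments_def)
    then have "m = n" by (metis diff_zero length_map length_upt)
    with y show ?thesis by (auto intro!: bexI[of _ y])
  qed
  then obtain Y where Y: "\<And>n. Y n \<in> P" "\<And>n i. i < n \<Longrightarrow> Y n i = x i"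
    by metis
  have "(\<lambda>n. Y n i) \<longlonglongrightarrow> x i" for i
    by (rule tendsto_eventually) (use Y(2) in \<open>auto simp: eventually_sequentially intro!: exI[of _ "Suc i"]\<close>)
  then have "Y \<longlonglongrightarrow> x"
    by (simp flip: limitin_canonical_iff euclidean_product_topology
        add: limitin_componentwise)
  then have "x \<in> C"
    by (rule Lim_in_closed_set[OF C(1) _ sequentially_bot, rotated]) (use Y(1) C(2) in auto)
  \<comment> \<open>\<open>P\<close> is closed relative to \<open>incr_seqs\<close>, so the limit
    must be shown increasing separately: neighbouring entries of \<open>x\<close> are copied from a
    single \<open>Y n\<close>.\<close>
  moreover have "x \<in> incr_seqs"
  proof -
    have "x i < x (Suc i)" for i
    proof -
      have "Y (Suc (Suc i)) i < Y (Suc (Suc i)) (Suc i)"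
        using Y(1)[of "Suc (Suc i)"] C(2) by (auto simp: incr_seqs_def strict_mono_Suc_iff)
      then show ?thesis by (simp add: Y(2))
    qed
    then show ?thesis by (simp add: incr_seqs_def strict_mono_Suc_iff)
  qed
  ultimately show ?thesis using C(2) by simp
qed

text \<open>Builds the interleaved branches for \<open>computes_decode\<close>; \<open>A\<close> is
  the set of rounds in which the block of \<open>z\<close> precedes that of
  \<open>y\<close>.\<close>

lemma superperfect_branches:
  assumes "superperfect P"
  obtains x y z I J K :: "nat \<Rightarrow> nat"
  where "x \<in> P" "y \<in> P" "z \<in> P" "I 0 = J 0" "\<And>i. i < I 0 \<Longrightarrow> x i = y i"
    "\<And>n i. i < J n \<Longrightarrow> y i \<le> x (I n)" "\<And>n. x (I n) < y (J n)"
    "\<And>n i. i < K n \<Longrightarrow> z i \<le> x (I n)" "\<And>n. x (I n) < z (K n)"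
    "\<And>n i. i < I (Suc n) \<Longrightarrow> x i \<le> y (J n)" "\<And>n. y (J n) < x (I (Suc n))"
    "\<And>n. z (K n) < y (J n) \<longleftrightarrow> n \<in> A"
proof -
  define T where "T = initial_segments P"
  have T: "superperfect_tree T"
    using assms by (simp add: superperfect_def T_def)
  then obtain s where s: "omega_splitting T s"
    unfolding superperfect_tree_def by blast
  \<comment> \<open>The sum of a node bounds its entries, so exceeding \<open>sum_list\<close> means
    exceeding all of them; the entry at the old length opens the new block.\<close>
  define step where "step n = (\<lambda>(u :: nat list, v :: nat list, w :: nat list) (u', v', w').
      strict_prefix u u' \<and> strict_prefix v v' \<and> strict_prefix w w' \<and>
      sum_list v < u' ! length u \<and> sum_list w < u' ! length u \<and>
      sum_list u' < v' ! length v \<and> sum_list u' < w' ! length w \<and>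
      (if n \<in> A then sum_list w' < v' ! length v else sum_list v' < w' ! length w))"
    for n
  \<comment> \<open>The common start \<open>s\<close> makes \<open>x\<close> and \<open>y\<close>
    agree below \<open>I 0\<close>.\<close>
  define nodes where "nodes n = (\<lambda>(u, v, w).
      omega_splitting T u \<and> omega_splitting T v \<and> omega_splitting T w \<and>
      (n = 0 \<longrightarrow> u = s \<and> v = s))"
    for n :: nat
  have "\<exists>S. \<forall>n. nodes n (S n) \<and> step n (S n) (S (Suc n))"
  proof (rule dependent_nat_choice)
    show "\<exists>S. nodes 0 S"
      using s by (auto simp: nodes_def)
  next
    fix S n
    assume "nodes n S"
    then obtain u v w where S: "S = (u, v, w)"
      and uvw: "omega_splitting T u" "omega_splitting T v" "omega_splitting T w"
      by (auto simp: nodes_def)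
    obtain u' where u': "omega_splitting T u'" "strict_prefix u u'"
      "sum_list v + sum_list w < u' ! length u"
      using omega_splitting_extend[OF T uvw(1)] by blast
    have "\<exists>v' w'. omega_splitting T v' \<and> omega_splitting T w' \<and>
        step n (u, v, w) (u', v', w')"
    \<comment> \<open>The block that comes first is chosen first, so that the other can start above
      it.\<close>
    proof (cases "n \<in> A")
      case True
      obtain w' where w': "omega_splitting T w'" "strict_prefix w w'"
        "sum_list u' < w' ! length w"
        using omega_splitting_extend[OF T uvw(3)] by blast
      obtain v' where v': "omega_splitting T v'" "strict_prefix v v'"
        "sum_list u' + sum_list w' < v' ! length v"
        using omega_splitting_extend[OF T uvw(2)] by blast
      show ?thesis
        using True u' v' w' by (intro exI[of _ v'] exI[of _ w']) (simp add: step_def)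
    next
      case False
      obtain v' where v': "omega_splitting T v'" "strict_prefix v v'"
        "sum_list u' < v' ! length v"
        using omega_splitting_extend[OF T uvw(2)] by blast
      obtain w' where w': "omega_splitting T w'" "strict_prefix w w'"
        "sum_list u' + sum_list v' < w' ! length w"
        using omega_splitting_extend[OF T uvw(3)] by blast
      show ?thesis
        using False u' v' w' by (intro exI[of _ v'] exI[of _ w']) (simp add: step_def)
    qed
    then show "\<exists>S'. nodes (Suc n) S' \<and> step n S S'"
      using u'(1) S by (auto simp: nodes_def)
  qed
  then obtain S where S: "\<And>n. nodes n (S n)" "\<And>n. step n (S n) (S (Suc n))"
    by metis
  define u v w where "u n = fst (S n)" and "v n = fst (snd (S n))" and "w n = snd (snd (S n))" for n
  have S_eq: "S n = (u n, v n, w n)" for n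
    by (simp add: u_def v_def w_def)
  have in_T: "u n \<in> T" "v n \<in> T" "w n \<in> T" for n
    using S(1)[of n] by (auto simp: S_eq nodes_def omega_splitting_def)
  have start: "u 0 = s" "v 0 = s"
    using S(1)[of 0] by (auto simp: S_eq nodes_def)
  have prefixes: "strict_prefix (u n) (u (Suc n))" "strict_prefix (v n) (v (Suc n))"
    "strict_prefix (w n) (w (Suc n))" for n
    using S(2)[of n] by (auto simp: S_eq step_def)
  obtain x where x: "\<And>n. map x [0..<length (u n)] = u n"
    using chain_limit[of u] prefixes(1) by blast
  obtain y where y: "\<And>n. map y [0..<length (v n)] = v n"
    using chain_limit[of v] prefixes(2) by blast
  obtain z where z: "\<And>n. map z [0..<length (w n)] = w n"
    using chain_limit[of w] prefixes(3) by blast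
  \<comment> \<open>Every initial segment of \<open>f\<close> is a prefix of some
    \<open>t n\<close>, and \<open>T\<close> is closed under prefixes.\<close>
  have branch: "f \<in> P"
    if f: "\<And>n. map f [0..<length (t n)] = t n" and "\<And>n. t n \<in> T"
      and t: "\<And>n. strict_prefix (t n) (t (Suc n))" for f and t :: "nat \<Rightarrow> nat list"
  proof (rule superperfect_branch[OF assms])
    fix n
    have "n \<le> length (t n)"
      using strict_mono_imp_increasing[of "\<lambda>n. length (t n)" n] prefix_length_less[OF t]
      by (simp add: strict_mono_Suc_iff)
    then have "map f [0..<n] = take n (map f [0..<length (t n)])"
      by (simp add: take_map)
    also have "\<dots> = take n (t n)"
      by (simp only: f)
    finally have "map f [0..<n] = take n (t n)" .
    then have "prefix (map f [0..<n]) (t n)"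
      by (simp add: take_is_prefix)
    then show "map f [0..<n] \<in> initial_segments P"
      using T \<open>t n \<in> T\<close> by (auto simp: superperfect_tree_def subtree_def T_def)
  qed
  have le_sum: "f i \<le> sum_list t"
    if "map f [0..<length t] = t" "i < length t" for f i and t :: "nat list"
  proof -
    have "f i \<in> set (map f [0..<length t])"
      using that(2) by simp
    then show ?thesis
      by (intro member_le_sum_list) (simp_all only: that(1) le0)
  qed
  have first: "t' ! length t = f (length t)"
    if "map f [0..<length t'] = t'" "strict_prefix t t'" for f and t t' :: "nat list"
  proof -
    have "t' ! length t = map f [0..<length t'] ! length t"
      by (simp only: that(1))
    then show ?thesis
      using prefix_length_less[OF that(2)] by simp
  qed
  define I J K where "I n = length (u n)" and "J n = length (v n)" and "K n = length (w n)" for n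
  have ineqs: "sum_list (v n) < x (I n)" "sum_list (w n) < x (I n)"
    "sum_list (u (Suc n)) < y (J n)" "sum_list (u (Suc n)) < z (K n)"
    "n \<in> A \<Longrightarrow> sum_list (w (Suc n)) < y (J n)" "n \<notin> A \<Longrightarrow> sum_list (v (Suc n)) < z (K n)" for n
    using S(2)[of n] first[OF x prefixes(1)] first[OF y prefixes(2)] first[OF z prefixes(3)]
    by (auto simp: S_eq step_def I_def J_def K_def)
  have less_Suc: "I n < I (Suc n)" "J n < J (Suc n)" "K n < K (Suc n)" for n
    unfolding I_def J_def K_def by (intro prefix_length_less prefixes)+
  have bounds: "i < I n \<Longrightarrow> x i \<le> sum_list (u n)" "i < J n \<Longrightarrow> y i \<le> sum_list (v n)"
    "i < K n \<Longrightarrow> z i \<le> sum_list (w n)" for i n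
    unfolding I_def J_def K_def by (intro le_sum x y z; assumption)+
  show thesis
  proof (rule that)
    show "x \<in> P" "y \<in> P" "z \<in> P"
      using branch x y z in_T prefixes by blast+
    show "I 0 = J 0" by (simp add: I_def J_def start)
    show "x i = y i" if "i < I 0" for i
    proof -
      have "map x [0..<length s] = map y [0..<length s]"
        using x[of 0] y[of 0] by (simp add: start)
      then show ?thesis
        using that by (simp add: I_def start)
    qed
    show "y i \<le> x (I n)" if "i < J n" for n i
      using bounds(2)[OF that] ineqs(1)[of n] by simp
    show "z i \<le> x (I n)" if "i < K n" for n i
      using bounds(3)[OF that] ineqs(2)[of n] by simp
    show "x i \<le> y (J n)" if "i < I (Suc n)" for n i
      using bounds(1)[OF that] ineqs(3)[of n] by simp
    \<comment> \<open>By \<open>I n < I (Suc n)\<close>, \<open>x (I n)\<close> is an entry of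
      \<open>u (Suc n)\<close>, whose sum the new entries of \<open>y\<close> and \<open>z\<close>
      exceed.\<close>
    show "x (I n) < y (J n)" "x (I n) < z (K n)" for n
      using bounds(1)[OF less_Suc(1), of n] ineqs(3,4)[of n] by simp_all
    show "y (J n) < x (I (Suc n))" for n
      using bounds(2)[OF less_Suc(2), of n] ineqs(1)[of "Suc n"] by simp
    \<comment> \<open>In either order, the opening entry of the earlier block belongs to a node
      whose sum the opening entry of the later block exceeds.\<close>
    show "z (K n) < y (J n) \<longleftrightarrow> n \<in> A" for n
      using bounds(2)[OF less_Suc(2), of n] bounds(3)[OF less_Suc(3), of n] ineqs(5,6)[of n]
      by (cases "n \<in> A") auto
  qed
qed

section \<open>Partial recursive functions\<close>

text \<open>The partial function that \<open>partial_recursive\<close> attaches to \<open>p\<close>;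
  the description is unambiguous because \<open>computes\<close> is deterministic.\<close>

definition prog_fun ::
    "prog \<Rightarrow> (nat \<Rightarrow> nat) \<times> (nat \<Rightarrow> nat) \<times> (nat \<Rightarrow> nat) \<rightharpoonup> (nat \<Rightarrow> nat)"
  where "prog_fun p = (\<lambda>(x, y, z).
    if x \<in> incr_seqs \<and> y \<in> incr_seqs \<and> z \<in> incr_seqs \<and>
      (\<exists>\<alpha>\<in>binary_seqs. \<forall>n. computes [x, y, z] p [n] (\<alpha> n))
    then Some (\<lambda>n. THE r. computes [x, y, z] p [n] r) else None)"

lemma prog_fun_eq_Some_iff:
  "prog_fun p (x, y, z) = Some \<alpha> \<longleftrightarrow>
    x \<in> incr_seqs \<and> y \<in> incr_seqs \<and> z \<in> incr_seqs \<and>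
    \<alpha> \<in> binary_seqs \<and> (\<forall>n. computes [x, y, z] p [n] (\<alpha> n))"
proof -
  have "(\<lambda>n. THE r. computes [x, y, z] p [n] r) = \<beta>" if "\<forall>n. computes [x, y, z] p [n] (\<beta> n)" for \<beta>
    using that by (auto intro!: ext the_equality intro: computes_deterministic)
  then show ?thesis by (auto simp: prog_fun_def)
qed

lemma partial_recursive_prog_fun: "partial_recursive (prog_fun p)"
  unfolding partial_recursive_def
proof (intro conjI exI[of _ p] ballI allI)
  show "dom (prog_fun p) \<subseteq> incr_seqs \<times> incr_seqs \<times> incr_seqs"
    by (auto simp: prog_fun_eq_Some_iff)
qed (simp add: prog_fun_eq_Some_iff)

theorem theorem1:
  "\<exists>f :: (nat \<Rightarrow> nat) \<times> (nat \<Rightarrow> nat) \<times> (nat \<Rightarrow> nat) \<rightharpoonup> (nat \<Rightarrow> nat).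
     partial_recursive f \<and>
     (\<forall>P. superperfect P \<longrightarrow>
        {\<alpha>. \<exists>x\<in>P. \<exists>y\<in>P. \<exists>z\<in>P. f (x, y, z) = Some \<alpha>} = binary_seqs)"
proof (intro exI[of _ "prog_fun decode_prog"] conjI allI impI)
  show "partial_recursive (prog_fun decode_prog)"
    by (rule partial_recursive_prog_fun)
  fix P
  assume P: "superperfect P"
  then have "P \<subseteq> incr_seqs"
    by (auto simp: superperfect_def closedin_closed)
  have "\<exists>x\<in>P. \<exists>y\<in>P. \<exists>z\<in>P. prog_fun decode_prog (x, y, z) = Some \<alpha>"
    if \<alpha>: "\<alpha> \<in> binary_seqs" for \<alpha>
  proof (rule superperfect_branches[OF P, where A = "{n. \<alpha> n = 1}"])
    fix x y z I J K :: "nat \<Rightarrow> nat"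
    assume xyz: "x \<in> P" "y \<in> P" "z \<in> P" and "I 0 = J 0" "\<And>i. i < I 0 \<Longrightarrow> x i = y i"
      "\<And>n i. i < J n \<Longrightarrow> y i \<le> x (I n)" "\<And>n. x (I n) < y (J n)"
      "\<And>n i. i < K n \<Longrightarrow> z i \<le> x (I n)" "\<And>n. x (I n) < z (K n)"
      "\<And>n i. i < I (Suc n) \<Longrightarrow> x i \<le> y (J n)" "\<And>n. y (J n) < x (I (Suc n))"
      "\<And>n. z (K n) < y (J n) \<longleftrightarrow> n \<in> {n. \<alpha> n = 1}"
    then have "computes [x, y, z] decode_prog [n] (\<alpha> n)" for n
      by (intro computes_decode[of I J x y K z \<alpha>] \<alpha>) simp_all
    then have "prog_fun decode_prog (x, y, z) = Some \<alpha>"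
      using xyz \<alpha> \<open>P \<subseteq> incr_seqs\<close> by (auto simp: prog_fun_eq_Some_iff)
    then show ?thesis using xyz by blast
  qed
  \<comment> \<open>The inclusion into \<open>binary_seqs\<close> holds because
    \<open>prog_fun\<close> is defined only where all digits are binary.\<close>
  then show "{\<alpha>. \<exists>x\<in>P. \<exists>y\<in>P. \<exists>z\<in>P. prog_fun decode_prog (x, y, z) = Some \<alpha>} = binary_seqs"
    by (auto simp: prog_fun_eq_Some_iff)
qed

end
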